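(* Every infinite-dimensional normed barrelled space has (algebraic) dimension at least $\operatorname{cov}(\mathcal{N})$.
   Context: A topological vector space is barrelled if every absolutely convex closed absorbing subset of it (a barrel) is a neighborhood of $0$; a normed barrelled space is a normed space (not necessarily complete) that is barrelled in its norm topology. Dimension means algebraic dimension, i.e. the cardinality of a Hamel basis. $\mathcal{N}$ is the ideal of Lebesgue null sets, and $\operatorname{cov}(\mathcal{N})$ is the minimal cardinality of a family of Lebesgue null sets whose union is the interval $[0,1]$. *)

theory Defs
  imports "HOL-Analysis.Analysis"
begin

unbundle cardinal_syntax

text \<open>Cardinals are the canonical cardinal orders of HOL; \<open>|A|\<close> is the cardinal of the set \<open>A\<close> and
  \<open>\<le>o\<close> compares cardinals across types.\<close>

definition null_cover :: "real set set \<Rightarrow> bool" where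
  "null_cover F \<longleftrightarrow> F \<subseteq> null_sets lebesgue \<and> \<Union>F = {0..1}"

definition cov_null :: "real set rel" where
  "cov_null = (SOME \<kappa>. (\<exists>F. null_cover F \<and> \<kappa> = |F| ) \<and> (\<forall>F. null_cover F \<longrightarrow> \<kappa> \<le>o |F| ))"

lemma null_cover_singletons: "null_cover ((\<lambda>x. {x}) ` {0..1})"
  by (auto simp: null_cover_def null_sets_def)

lemma cov_null_spec:
  "(\<exists>F. null_cover F \<and> cov_null = |F| ) \<and> (\<forall>F. null_cover F \<longrightarrow> cov_null \<le>o |F| )"
proof -
  let ?R = "{|F| | F. null_cover F}"
  have "?R \<noteq> {}"
    using null_cover_singletons by blast
  moreover have "\<forall>r\<in>?R. Card_order r"
    by (auto simp: card_of_Card_order)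
  ultimately obtain \<kappa> where "\<kappa> \<in> ?R" "\<forall>r\<in>?R. \<kappa> \<le>o r"
    using exists_minim_Card_order[of ?R] by blast
  then have "(\<exists>F. null_cover F \<and> \<kappa> = |F| ) \<and> (\<forall>F. null_cover F \<longrightarrow> \<kappa> \<le>o |F| )"
    by blast
  then show ?thesis
    unfolding cov_null_def by (rule someI)
qed

text \<open>The notions below take the scalar multiplication as a parameter, so that they apply to real
  and to complex spaces. The library has no class of complex normed spaces: such a space is given by
  a complex scalar multiplication on a type of class \<^class>\<open>real_normed_vector\<close>, which
  supplies addition, norm and topology.\<close>

definition hamel_basis :: "('k::field \<Rightarrow> 'a::ab_group_add \<Rightarrow> 'a) \<Rightarrow> 'a set \<Rightarrow> bool" where
  "hamel_basis sc B \<longleftrightarrow> \<not> module.dependent sc B \<and> module.span sc B = UNIV"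

definition alg_dim :: "('k::field \<Rightarrow> 'a::ab_group_add \<Rightarrow> 'a) \<Rightarrow> 'a rel" where
  "alg_dim sc = |SOME B. hamel_basis sc B|"

lemma hamel_basis_exists:
  assumes "vector_space sc"
  shows "\<exists>B. hamel_basis sc B"
proof -
  interpret vector_space sc by fact
  have "hamel_basis sc (extend_basis {})"
    unfolding hamel_basis_def
    using independent_extend_basis[OF independent_empty] span_extend_basis[OF independent_empty]
    by blast
  then show ?thesis ..
qed

lemma alg_dim_eq:
  assumes "vector_space sc" and B: "hamel_basis sc B"
  shows "alg_dim sc =o |B|"
proof -
  interpret vector_space sc by fact
  define C where "C = (SOME B. hamel_basis sc B)"
  have "hamel_basis sc C"
    unfolding C_def using B by (rule someI)
  with B obtain f where "bij_betw f C B"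
    unfolding hamel_basis_def by (metis bij_if_span_eq_span_bases)
  then show ?thesis
    unfolding alg_dim_def C_def[symmetric] using card_of_ordIso by blast
qed

definition absolutely_convex :: "('k::real_normed_field \<Rightarrow> 'a::real_normed_vector \<Rightarrow> 'a) \<Rightarrow> 'a set \<Rightarrow> bool" where
  "absolutely_convex sc T \<longleftrightarrow> convex T \<and> (\<forall>c. \<forall>x\<in>T. norm c \<le> 1 \<longrightarrow> sc c x \<in> T)"

definition absorbing :: "('k::real_normed_field \<Rightarrow> 'a::real_normed_vector \<Rightarrow> 'a) \<Rightarrow> 'a set \<Rightarrow> bool" where
  "absorbing sc T \<longleftrightarrow> (\<forall>x. \<exists>r>0. \<forall>c. norm c \<ge> r \<longrightarrow> x \<in> sc c ` T)"

definition barrel :: "('k::real_normed_field \<Rightarrow> 'a::real_normed_vector \<Rightarrow> 'a) \<Rightarrow> 'a set \<Rightarrow> bool" where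
  "barrel sc T \<longleftrightarrow> absolutely_convex sc T \<and> closed T \<and> absorbing sc T"

text \<open>The assumption \<open>scale_of_real\<close> makes the real structure of the type class (used by
  \<^const>\<open>convex\<close>) the restriction of \<open>sc\<close> to the reals. It is not an extra restriction on the space:
  every complex normed space satisfies it once regarded as a real one.\<close>

locale normed_space = vector_space sc
  for sc :: "'k::real_normed_field \<Rightarrow> 'a::real_normed_vector \<Rightarrow> 'a" +
  assumes norm_scale: "norm (sc c x) = norm c * norm x"
    and scale_of_real: "sc (of_real t) x = t *\<^sub>R x"

locale normed_barrelled_space = normed_space sc
  for sc :: "'k::real_normed_field \<Rightarrow> 'a::real_normed_vector \<Rightarrow> 'a" +
  assumes barrelled: "barrel sc T \<Longrightarrow> 0 \<in> interior T"

lemma normed_space_scaleR: "normed_space ((*\<^sub>R) :: real \<Rightarrow> 'a::real_normed_vector \<Rightarrow> 'a)"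
  by unfold_locales (auto simp: algebra_simps)

end

theory Submission
  imports Defs "HOL-Real_Asymp.Real_Asymp"
begin

text \<open>
  In a barrelled space every pointwise bounded sequence of continuous functionals is norm bounded,
  because the common unit polar of such a sequence is a barrel. In infinite dimension there is a family
  \<open>f\<^sub>w\<close>, \<open>w \<in> [0,1]\<close>, of norm unbounded sequences of functionals with the property that for every
  single point \<open>x\<close> the sequence \<open>f\<^sub>w(x)\<close> is bounded for almost every \<open>w\<close>. Then each
  \<open>Z(x) = {w. f\<^sub>w(x) is unbounded}\<close> is null. If \<open>S\<close> spans the space, the sets \<open>Z(x)\<close> with \<open>x \<in> S\<close>
  cover \<open>[0,1]\<close>: a \<open>w\<close> outside all of them would give a sequence that is bounded at every point of
  \<open>S\<close>, hence at every point of its span, and yet norm unbounded. So \<open>S\<close> has at least \<open>cov(N)\<close>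
  elements.

  Such a random sequence comes from a Dvoretzky--Rogers lemma in the dual (\<open>dvoretzky_rogers\<close>):
  for each \<open>N\<close> there are functionals \<open>g\<^sub>0, \<dots>, g\<^bsub>N-1\<^esub>\<close> of norm at least \<open>1/\<surd>2\<close> with
  \<open>\<Sum> g\<^sub>k(x)\<^sup>2 \<le> \<parallel>x\<parallel>\<^sup>2\<close> for all \<open>x\<close>. Take \<open>N = 8\<^sup>n\<close>, choose \<open>k\<close> uniformly below \<open>8\<^sup>n\<close> by means of the
  first \<open>n\<close> octal digits of \<open>w\<close>, and let the \<open>n\<close>-th functional be \<open>2\<^sup>n g\<^sub>k\<close>. At most
  \<open>4\<^sup>n \<parallel>x\<parallel>\<^sup>2\<close> of the \<open>8\<^sup>n\<close> indices give a value above \<open>1\<close> at \<open>x\<close>, so the exceptional sets have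
  summable measure and the Borel--Cantelli lemma applies (\<open>unbounded_selection_null\<close>).

  The Dvoretzky--Rogers lemma is obtained from a rank count. A family of functionals maps
  coefficient vectors to linear combinations. Rotating a family of \<open>n\<close> functionals orthogonally, one either finds \<open>N\<close> orthonormal
  coefficient vectors with large images, which up to scaling are the desired functionals, or can
  discard at most \<open>N\<close> dimensions so that the squared norm bound is halved on the rest (\<open>extract_or_shrink\<close>). If the
  first case never occurs, iteration yields a nonzero coefficient vector whose image is
  exponentially small in \<open>n / N\<close>. This is impossible if the norms of the
  images of unit vectors are initially bounded below by a power of \<open>1 / n\<close>, as they are for a basic
  sequence whose coordinate functionals grow linearly (\<open>slow_basic_exists\<close>);
  it is built by Mazur's method, from the Hahn--Banach theorem and the compactness of boxes in finite-dimensional spaces.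

  Complex scalars reduce to real ones: a complex Hamel basis \<open>B\<close> gives the real spanning set
  \<open>B \<union> \<i>B\<close> of the same infinite cardinality.
\<close>

section \<open>The Hahn--Banach theorem for sublinear functionals\<close>

definition sublinear :: "('a::real_vector \<Rightarrow> real) \<Rightarrow> bool" where
  "sublinear p \<longleftrightarrow> (\<forall>x y. p (x + y) \<le> p x + p y) \<and> (\<forall>t\<ge>0. \<forall>x. p (t *\<^sub>R x) = t * p x)"

lemma sublinear_add: "sublinear p \<Longrightarrow> p (x + y) \<le> p x + p y"
  and sublinear_scale: "sublinear p \<Longrightarrow> t \<ge> 0 \<Longrightarrow> p (t *\<^sub>R x) = t * p x"
  by (auto simp: sublinear_def)

lemma sublinear_zero: "sublinear p \<Longrightarrow> p 0 = 0"
  using sublinear_scale[of p 0 0] by simp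

lemma sublinear_neg: "sublinear p \<Longrightarrow> - p (- x) \<le> p x"
  using sublinear_add[of p x "- x"] sublinear_zero[of p] by simp

text \<open>Pointwise infima of sublinear functionals need not be subadditive. Here a third index may witness
  subadditivity and positive homogeneity, which covers the infima of chains as well as the tilts
  defined below, where the individual functions are not sublinear.\<close>

lemma sublinear_Inf:
  fixes P :: "'i \<Rightarrow> 'a::real_vector \<Rightarrow> real"
  assumes ne: "I \<noteq> {}"
    and bdd: "\<And>x. bdd_below ((\<lambda>i. P i x) ` I)"
    and add: "\<And>i j x y. i \<in> I \<Longrightarrow> j \<in> I \<Longrightarrow> \<exists>k\<in>I. P k (x + y) \<le> P i x + P j y"
    and scale: "\<And>i t x. i \<in> I \<Longrightarrow> t > 0 \<Longrightarrow> \<exists>k\<in>I. P k (t *\<^sub>R x) \<le> t * P i x"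
    and zero: "\<And>i. i \<in> I \<Longrightarrow> P i 0 = 0"
  shows "sublinear (\<lambda>x. INF i\<in>I. P i x)"
proof -
  let ?q = "\<lambda>x. INF i\<in>I. P i x"
  have low: "?q x \<le> P i x" if "i \<in> I" for i x
    using bdd that by (rule cINF_lower)
  have half: "?q (t *\<^sub>R x) \<le> t * ?q x" if t: "t > 0" for t x
  proof -
    have "?q (t *\<^sub>R x) / t \<le> ?q x"
    proof (rule cINF_greatest[OF ne])
      fix i assume "i \<in> I"
      then obtain k where "k \<in> I" "P k (t *\<^sub>R x) \<le> t * P i x" using scale t by blast
      then have "?q (t *\<^sub>R x) \<le> t * P i x" using low order_trans by blast
      then show "?q (t *\<^sub>R x) / t \<le> P i x" using t by (simp add: field_simps)
    qed
    then show ?thesis using t by (simp add: field_simps)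
  qed
  have "?q (x + y) \<le> ?q x + ?q y" for x y
  proof -
    have "?q (x + y) - P j y \<le> ?q x" if j: "j \<in> I" for j
    proof (rule cINF_greatest[OF ne])
      fix i assume "i \<in> I"
      then obtain k where "k \<in> I" "P k (x + y) \<le> P i x + P j y" using add j by blast
      then show "?q (x + y) - P j y \<le> P i x" using low[of k "x + y"] by linarith
    qed
    then have "?q (x + y) - ?q x \<le> ?q y"
      by (intro cINF_greatest[OF ne]) (simp add: algebra_simps)
    then show ?thesis by linarith
  qed
  moreover have "?q (t *\<^sub>R x) = t * ?q x" if "t \<ge> 0" for t x
  proof (cases "t = 0")
    case True
    have "?q 0 = (INF i\<in>I. 0)" using zero by (intro INF_cong) auto
    then show ?thesis using True ne by simp
  next
    case False
    with that have t: "t > 0" by simp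
    have "?q ((1 / t) *\<^sub>R (t *\<^sub>R x)) \<le> (1 / t) * ?q (t *\<^sub>R x)"
      using half[of "1 / t" "t *\<^sub>R x"] t by simp
    then have "t * ?q x \<le> ?q (t *\<^sub>R x)" using t by (simp add: field_simps)
    then show ?thesis using half[OF t, of x] by linarith
  qed
  ultimately show ?thesis unfolding sublinear_def by blast
qed

text \<open>The largest sublinear functional below \<open>q\<close> whose value at \<open>- y\<close> is at most \<open>- q y\<close>. It serves
  twice below: it forces a functional to attain \<open>q\<close> at \<open>y\<close>, and it shows that minimal sublinear
  functionals are odd.\<close>

definition tilt :: "('a::real_vector \<Rightarrow> real) \<Rightarrow> 'a \<Rightarrow> 'a \<Rightarrow> real" where
  "tilt q y x = (INF t\<in>{0..}. q (x + t *\<^sub>R y) - t * q y)"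

lemma tilt_bdd:
  assumes q: "sublinear q"
  shows "bdd_below ((\<lambda>t. q (x + t *\<^sub>R y) - t * q y) ` {0..})"
proof (rule bdd_belowI2)
  fix t :: real assume "t \<in> {0..}"
  then have "t * q y = q ((x + t *\<^sub>R y) + - x)" using sublinear_scale[OF q, of t y] by simp
  also have "\<dots> \<le> q (x + t *\<^sub>R y) + q (- x)" by (rule sublinear_add[OF q])
  finally show "- q (- x) \<le> q (x + t *\<^sub>R y) - t * q y" by simp
qed

lemma tilt_le: "sublinear q \<Longrightarrow> t \<ge> 0 \<Longrightarrow> tilt q y x \<le> q (x + t *\<^sub>R y) - t * q y"
  unfolding tilt_def by (rule cINF_lower[OF tilt_bdd]) auto

lemma sublinear_tilt:
  assumes q: "sublinear q"
  shows "sublinear (tilt q y)"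
proof -
  have "sublinear (\<lambda>x. INF t\<in>{0..}. q (x + t *\<^sub>R y) - t * q y)"
  proof (rule sublinear_Inf)
    fix s t :: real and x z assume st: "s \<in> {0..}" "t \<in> {0..}"
    have "q (x + z + (s + t) *\<^sub>R y) \<le> q (x + s *\<^sub>R y) + q (z + t *\<^sub>R y)"
      using sublinear_add[OF q, of "x + s *\<^sub>R y" "z + t *\<^sub>R y"] by (simp add: algebra_simps)
    then show "\<exists>k\<in>{0..}. q (x + z + k *\<^sub>R y) - k * q y
        \<le> q (x + s *\<^sub>R y) - s * q y + (q (z + t *\<^sub>R y) - t * q y)"
      using st by (intro bexI[of _ "s + t"]) (auto simp: algebra_simps)
  next
    fix s t :: real and x assume st: "s \<in> {0..}" "t > 0"
    have "q (t *\<^sub>R x + (t * s) *\<^sub>R y) = t * q (x + s *\<^sub>R y)"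
      using sublinear_scale[OF q, of t "x + s *\<^sub>R y"] st by (simp add: algebra_simps)
    then show "\<exists>k\<in>{0..}. q (t *\<^sub>R x + k *\<^sub>R y) - k * q y \<le> t * (q (x + s *\<^sub>R y) - s * q y)"
      using st by (intro bexI[of _ "t * s"]) (auto simp: algebra_simps)
  qed (use tilt_bdd[OF q] sublinear_scale[OF q] in auto)
  then show ?thesis by (simp add: tilt_def[abs_def])
qed

lemma tilt_le_self: "sublinear q \<Longrightarrow> tilt q y x \<le> q x"
  using tilt_le[of q 0 y x] by simp

lemma tilt_neg: "sublinear q \<Longrightarrow> tilt q y (- y) \<le> - q y"
  using tilt_le[of q 1 y "- y"] sublinear_zero[of q] by simp

lemma minimal_sublinear_exists:
  assumes p: "sublinear p"
  obtains m where "sublinear m" "m \<le> p" "\<And>q. sublinear q \<Longrightarrow> q \<le> m \<Longrightarrow> q = m"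
proof -
  let ?A = "{q. sublinear q \<and> q \<le> p}"
  have "\<exists>m\<in>?A. \<forall>a\<in>?A. a \<le> m \<longrightarrow> a = m"
  proof (rule predicate_Zorn[where P = "\<lambda>q r. r \<le> q"])
    show "partial_order_on ?A (relation_of (\<lambda>q r. r \<le> q) ?A)"
      by (rule partial_order_on_relation_ofI) auto
  next
    fix C assume C: "C \<in> Chains (relation_of (\<lambda>q r. r \<le> q) ?A)"
    have CA: "C \<subseteq> ?A" using C by (rule Chains_relation_of)
    have cmp: "q \<le> r \<or> r \<le> q" if "q \<in> C" "r \<in> C" for q r
      using C that unfolding Chains_def relation_of_def by blast
    show "\<exists>u\<in>?A. \<forall>a\<in>C. u \<le> a"
    proof (cases "C = {}")
      case True
      then show ?thesis using p by auto
    next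
      case False
      let ?u = "\<lambda>x. INF q\<in>C. q x"
      have bdd: "bdd_below ((\<lambda>q. q x) ` C)" for x
      proof (rule bdd_belowI2)
        fix q assume "q \<in> C"
        then have "sublinear q" "q (- x) \<le> p (- x)" using CA by (auto simp: le_fun_def)
        then show "- p (- x) \<le> q x" using sublinear_neg[of q x] by linarith
      qed
      \<comment> \<open>In a chain, the smaller of two members serves as the common bound for subadditivity.\<close>
      have "sublinear ?u"
      proof (rule sublinear_Inf[OF False bdd])
        fix q r x y assume qr: "q \<in> C" "r \<in> C"
        have *: "\<exists>k\<in>C. k \<le> q \<and> k \<le> r" using cmp[OF qr] qr by auto
        then obtain k where k: "k \<in> C" "k \<le> q" "k \<le> r" by blast
        then have "k (x + y) \<le> k x + k y" using CA by (auto intro: sublinear_add)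
        also have "\<dots> \<le> q x + r y" using k by (auto simp: le_fun_def intro: add_mono)
        finally show "\<exists>k\<in>C. k (x + y) \<le> q x + r y" using k by blast
      next
        fix q and t :: real and x assume "q \<in> C" "t > 0"
        then show "\<exists>k\<in>C. k (t *\<^sub>R x) \<le> t * q x"
          using CA sublinear_scale[of q t x] by (intro bexI[of _ q]) auto
      qed (use CA sublinear_zero in auto)
      moreover have low: "?u \<le> q" if "q \<in> C" for q
        using cINF_lower[OF bdd that] by (simp add: le_fun_def)
      moreover have "?u \<le> p"
        using False low CA by (metis (no_types, lifting) all_not_in_conv mem_Collect_eq order_trans subsetD)
      ultimately show ?thesis by blast
    qed
  qed
  then obtain m where "sublinear m" "m \<le> p" "\<forall>a\<in>?A. a \<le> m \<longrightarrow> a = m" by auto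
  then show thesis using that[of m] by (metis (mono_tags, lifting) mem_Collect_eq order_trans)
qed

text \<open>A minimal sublinear functional \<open>m\<close> equals all of its tilts, so \<open>m (- y) \<le> - m y\<close>; a sublinear
  functional with this property is linear. Starting the minimization from the tilt of \<open>p\<close> along
  \<open>x0\<close> makes the result attain \<open>p\<close> at \<open>x0\<close>.\<close>

theorem Hahn_Banach_sublinear:
  assumes p: "sublinear p"
  obtains f where "linear f" "\<And>x. f x \<le> p x" "f x0 = p x0"
proof -
  obtain m where m: "sublinear m" and mp: "m \<le> tilt p x0"
    and min: "\<And>q. sublinear q \<Longrightarrow> q \<le> m \<Longrightarrow> q = m"
    using minimal_sublinear_exists[OF sublinear_tilt[OF p]] by metis
  have tilt_m: "tilt m y = m" for y
    by (rule min) (auto simp: le_fun_def intro: sublinear_tilt tilt_le_self m)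
  have odd: "m (- y) = - m y" for y
    using tilt_neg[OF m, of y] sublinear_neg[OF m, of y] tilt_m[of y] by simp
  have add: "m (x + y) = m x + m y" for x y
    using sublinear_add[OF m, of x y] sublinear_add[OF m, of "x + y" "- y"] odd[of y] by simp
  have scale: "m (t *\<^sub>R x) = t * m x" for t x
  proof (cases "t \<ge> 0")
    case False
    then have "m (- ((- t) *\<^sub>R x)) = t * m x" unfolding odd using sublinear_scale[OF m, of "- t" x] by simp
    then show ?thesis by simp
  qed (simp add: sublinear_scale[OF m])
  have "linear m" by (rule linearI) (auto simp: add scale)
  moreover have le: "m x \<le> p x" for x
    using mp tilt_le_self[OF p] by (metis le_funD order_trans)
  moreover have "m (- x0) \<le> - p x0"
    using mp tilt_neg[OF p] by (metis le_funD order_trans)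
  then have "m x0 = p x0" using odd[of x0] le[of x0] by simp
  ultimately show thesis by (rule that)
qed

lemma norming_functional:
  fixes x :: "'a::real_normed_vector"
  obtains f :: "'a \<Rightarrow>\<^sub>L real" where "norm f \<le> 1" "blinfun_apply f x = norm x"
proof -
  have "sublinear (norm :: 'a \<Rightarrow> real)"
    by (auto simp: sublinear_def norm_triangle_ineq)
  then obtain f where f: "linear f" "\<And>y. f y \<le> norm y" "f x = norm x"
    by (rule Hahn_Banach_sublinear[where ?x0.0 = x]) blast
  have bound: "\<bar>f y\<bar> \<le> norm y" for y
    using f(2)[of y] f(2)[of "- y"] linear_neg[OF f(1)] by simp
  then have bl: "bounded_linear f"
    using f(1) by (intro bounded_linear_intro[of f 1]) (auto simp: linear_add linear_scale)
  show thesis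
  proof (rule that[of "Blinfun f"])
    show "norm (Blinfun f) \<le> 1"
      using bound bl by (intro norm_blinfun_bound) (auto simp: bounded_linear_Blinfun_apply)
  qed (simp add: bl bounded_linear_Blinfun_apply f(3))
qed

section \<open>Annihilating functionals\<close>

text \<open>Intersecting with the kernel of one functional lowers the dimension by at most one: if \<open>g s \<noteq> 0\<close>,
  every \<open>v\<close> differs from an element of the kernel by a multiple of \<open>s\<close>.\<close>

lemma kernel_infinite_dimensional:
  fixes S :: "'a::real_vector set" and G :: "('a \<Rightarrow> real) set"
  assumes "finite G" "\<And>g. g \<in> G \<Longrightarrow> linear g"
    and S: "subspace S" "\<nexists>X. finite X \<and> S \<subseteq> span X"
  shows "\<nexists>X. finite X \<and> {v \<in> S. \<forall>g\<in>G. g v = 0} \<subseteq> span X"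
  using assms(1,2)
proof (induction G)
  case empty
  then show ?case using S by simp
next
  case (insert g G)
  let ?K = "{v \<in> S. \<forall>g\<in>G. g v = 0}"
  have IH: "\<nexists>X. finite X \<and> ?K \<subseteq> span X" using insert by simp
  have lin: "linear g" using insert by simp
  show ?case
  proof
    assume "\<exists>X. finite X \<and> {v \<in> S. \<forall>g\<in>insert g G. g v = 0} \<subseteq> span X"
    then obtain X where X: "finite X" "{v \<in> S. \<forall>g\<in>insert g G. g v = 0} \<subseteq> span X" by blast
    show False
    proof (cases "\<exists>s\<in>?K. g s \<noteq> 0")
      case False
      then show False using X IH by blast
    next
      case True
      then obtain s where s: "s \<in> ?K" "g s \<noteq> 0" by blast
      have "v \<in> span (insert s X)" if v: "v \<in> ?K" for v
      proof -
        let ?w = "v - (g v / g s) *\<^sub>R s"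
        have "?w \<in> S" using s v S(1) by (simp add: subspace_diff subspace_scale)
        moreover have "\<forall>h\<in>G. h ?w = 0"
          using s v insert.prems by (auto simp: linear_diff linear_scale)
        moreover have "g ?w = 0" using s(2) by (simp add: linear_diff[OF lin] linear_scale[OF lin])
        ultimately have "?w \<in> span X" using X(2) by auto
        then show ?thesis unfolding span_insert by blast
      qed
      then have "?K \<subseteq> span (insert s X)" by blast
      then show False using IH X(1) by blast
    qed
  qed
qed

lemma common_zero:
  fixes G :: "('a::real_vector \<Rightarrow> real) set"
  assumes "finite G" "\<And>g. g \<in> G \<Longrightarrow> linear g"
    and "\<nexists>X. finite X \<and> (UNIV :: 'a set) \<subseteq> span X"
  obtains v where "v \<noteq> 0" "\<And>g. g \<in> G \<Longrightarrow> g v = 0"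
proof -
  have "\<nexists>X. finite X \<and> {v \<in> UNIV. \<forall>g\<in>G. g v = 0} \<subseteq> span X"
    using assms by (intro kernel_infinite_dimensional) auto
  then have "\<not> {v \<in> UNIV. \<forall>g\<in>G. g v = 0} \<subseteq> span {}"
    by (metis (no_types, lifting) finite.emptyI)
  then show thesis using that by auto
qed

text \<open>If finitely many functionals spanned the dual, a nonzero common zero \<open>x\<close> of theirs would be
  annihilated by the whole dual, against the Hahn--Banach theorem.\<close>

lemma dual_infinite_dimensional:
  assumes "\<nexists>X. finite X \<and> (UNIV :: 'a::real_normed_vector set) \<subseteq> span X"
  shows "\<nexists>X. finite X \<and> (UNIV :: ('a \<Rightarrow>\<^sub>L real) set) \<subseteq> span X"
proof
  assume "\<exists>X. finite X \<and> (UNIV :: ('a \<Rightarrow>\<^sub>L real) set) \<subseteq> span X"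
  then obtain G :: "('a \<Rightarrow>\<^sub>L real) set" where G: "finite G" "UNIV \<subseteq> span G" by blast
  have "linear g" if "g \<in> blinfun_apply ` G" for g
    using that by (auto intro: bounded_linear.linear blinfun.bounded_linear_right)
  then obtain x where x: "x \<noteq> 0" "\<And>g. g \<in> G \<Longrightarrow> blinfun_apply g x = 0"
    by (rule common_zero[of "blinfun_apply ` G", OF finite_imageI[OF G(1)] _ assms]) auto
  obtain f :: "'a \<Rightarrow>\<^sub>L real" where f: "blinfun_apply f x = norm x"
    using norming_functional by blast
  have "subspace {g :: 'a \<Rightarrow>\<^sub>L real. blinfun_apply g x = 0}"
    by (auto simp: subspace_def blinfun.add_left blinfun.scaleR_left)
  then have "span G \<subseteq> {g. blinfun_apply g x = 0}"
    using x(2) by (intro span_minimal) auto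
  then have "blinfun_apply f x = 0" using G(2) by auto
  with f x(1) show False by simp
qed

lemma annihilating_unit_functional:
  fixes X :: "'a::real_normed_vector set"
  assumes inf: "\<nexists>Y. finite Y \<and> (UNIV :: 'a set) \<subseteq> span Y"
    and X: "finite X"
  obtains f :: "'a \<Rightarrow>\<^sub>L real" where "norm f = 1" "\<And>x. x \<in> X \<Longrightarrow> blinfun_apply f x = 0"
proof -
  let ?ev = "\<lambda>x (f :: 'a \<Rightarrow>\<^sub>L real). blinfun_apply f x"
  have "linear g" if "g \<in> ?ev ` X" for g
    using that by (auto intro: bounded_linear.linear blinfun.bounded_linear_left)
  then obtain f :: "'a \<Rightarrow>\<^sub>L real" where f: "f \<noteq> 0" "\<And>x. x \<in> X \<Longrightarrow> blinfun_apply f x = 0"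
    by (rule common_zero[of "?ev ` X", OF finite_imageI[OF X] _ dual_infinite_dimensional[OF inf]]) auto
  show thesis
    by (rule that[of "(1 / norm f) *\<^sub>R f"]) (use f in \<open>auto simp: blinfun.scaleR_left\<close>)
qed

section \<open>Basic sequences with linearly growing coordinates\<close>

text \<open>With \<open>P\<^sub>k\<close> for the \<open>k\<close>-th partial sum of a combination, the condition says that
  \<open>k \<parallel>P\<^sub>k\<parallel>\<close> increases with \<open>k\<close>, so that the partial-sum projections of a family of \<open>m\<close> vectors have
  norm at most \<open>m\<close>. Any subexponential growth would do for the rank count; the factor
  \<open>(k + 1) / k > 1\<close> leaves the room that Mazur's inductive construction needs.\<close>

definition slow_basic :: "(nat \<Rightarrow> 'v::real_normed_vector) \<Rightarrow> nat \<Rightarrow> bool" where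
  "slow_basic f m \<longleftrightarrow> (\<forall>i<m. norm (f i) = 1) \<and>
     (\<forall>a. \<forall>k<m. real k * norm (\<Sum>i<k. a i *\<^sub>R f i) \<le> (real k + 1) * norm (\<Sum>i<Suc k. a i *\<^sub>R f i))"

lemma slow_basic_coefficient:
  assumes f: "slow_basic f m" and k: "k < m"
  shows "\<bar>a k\<bar> \<le> 2 * real m * norm (\<Sum>i<m. a i *\<^sub>R f i)"
proof -
  let ?P = "\<lambda>k. \<Sum>i<k. a i *\<^sub>R f i"
  have mono: "real l * norm (?P l) \<le> real m * norm (?P m)" if "l \<le> m" for l
    using that
  proof (induction rule: inc_induct)
    case (step l)
    then have "real l * norm (?P l) \<le> real (Suc l) * norm (?P (Suc l))"
      using f unfolding slow_basic_def by (simp add: add.commute)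
    with step.IH show ?case by (rule order_trans[rotated])
  qed simp
  have part: "norm (?P l) \<le> real m * norm (?P m)" if "l \<le> m" for l
  proof (cases "l = 0")
    case False
    then have "1 * norm (?P l) \<le> real l * norm (?P l)" by (intro mult_right_mono) auto
    then show ?thesis using mono[OF that] by simp
  qed simp
  have "\<bar>a k\<bar> = norm (?P (Suc k) - ?P k)"
    using f k unfolding slow_basic_def by simp
  also have "\<dots> \<le> norm (?P (Suc k)) + norm (?P k)" by (rule norm_triangle_ineq4)
  also have "\<dots> \<le> real m * norm (?P m) + real m * norm (?P m)"
    using k by (intro add_mono part) auto
  finally show ?thesis by simp
qed

lemma compact_box_combinations:
  fixes f :: "nat \<Rightarrow> 'v::real_normed_vector"
  shows "compact {\<Sum>i<m. a i *\<^sub>R f i |a. \<forall>i<m. \<bar>a i\<bar> \<le> C}"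
proof (induction m)
  case (Suc m)
  let ?K = "\<lambda>m. {\<Sum>i<m. a i *\<^sub>R f i |a. \<forall>i<m. \<bar>a i\<bar> \<le> C}"
  have "?K (Suc m) = {x + y |x y. x \<in> ?K m \<and> y \<in> (\<lambda>t. t *\<^sub>R f m) ` {-C..C}}"
  proof (intro set_eqI iffI)
    fix z assume "z \<in> ?K (Suc m)"
    then obtain a where "z = (\<Sum>i<Suc m. a i *\<^sub>R f i)" "\<forall>i<Suc m. \<bar>a i\<bar> \<le> C" by blast
    moreover from this have "\<bar>a m\<bar> \<le> C" by simp
    then have "a m \<in> {-C..C}" by (simp add: abs_le_iff)
    ultimately show "z \<in> {x + y |x y. x \<in> ?K m \<and> y \<in> (\<lambda>t. t *\<^sub>R f m) ` {-C..C}}"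
      by (intro CollectI exI[of _ "\<Sum>i<m. a i *\<^sub>R f i"] exI[of _ "a m *\<^sub>R f m"]) auto
  next
    fix z assume "z \<in> {x + y |x y. x \<in> ?K m \<and> y \<in> (\<lambda>t. t *\<^sub>R f m) ` {-C..C}}"
    then obtain a t where "z = (\<Sum>i<m. a i *\<^sub>R f i) + t *\<^sub>R f m" "\<forall>i<m. \<bar>a i\<bar> \<le> C" "t \<in> {-C..C}"
      by blast
    then show "z \<in> ?K (Suc m)"
      by (intro CollectI exI[of _ "a(m := t)"]) (auto simp: less_Suc_eq)
  qed
  moreover have "compact ((\<lambda>t. t *\<^sub>R f m) ` {-C..C})"
    by (intro compact_continuous_image continuous_intros) auto
  ultimately show ?case using compact_sums[OF Suc.IH] by simp
qed simp

text \<open>The span of the family has a compact unit sphere because its coefficients are bounded there, and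
  each functional of norm one exceeds \<open>c\<close> at some point of the unit ball. Finitely many points
  therefore suffice for the whole span.\<close>

lemma finite_norming_set:
  fixes f :: "nat \<Rightarrow> 'a::real_normed_vector \<Rightarrow>\<^sub>L real"
  assumes f: "slow_basic f m" and c: "0 \<le> c" "c < 1"
  shows "\<exists>X. finite X \<and> (\<forall>x\<in>X. norm x \<le> 1) \<and>
    (\<forall>a. (\<Sum>i<m. a i *\<^sub>R f i) \<noteq> 0 \<longrightarrow>
      (\<exists>x\<in>X. c * norm (\<Sum>i<m. a i *\<^sub>R f i) < blinfun_apply (\<Sum>i<m. a i *\<^sub>R f i) x))"
proof -
  let ?S = "{\<Sum>i<m. a i *\<^sub>R f i |a. \<forall>i<m. \<bar>a i\<bar> \<le> 2 * real m} \<inter> sphere 0 1"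
  let ?U = "\<lambda>x :: 'a. {v :: 'a \<Rightarrow>\<^sub>L real. c < blinfun_apply v x}"
  have "closed (sphere 0 1 :: ('a \<Rightarrow>\<^sub>L real) set)"
    unfolding sphere_def by (intro closed_Collect_eq continuous_intros)
  then have "compact ?S" by (intro compact_Int_closed compact_box_combinations)
  moreover have "open (?U x)" for x
    by (intro open_Collect_less continuous_intros)
  moreover have "?S \<subseteq> (\<Union>x\<in>cball 0 1. ?U x)"
  proof
    fix v assume "v \<in> ?S"
    then have v: "norm v = 1" by simp
    show "v \<in> (\<Union>x\<in>cball 0 1. ?U x)"
    proof (rule ccontr)
      assume "v \<notin> (\<Union>x\<in>cball 0 1. ?U x)"
      then have le: "blinfun_apply v x \<le> c" if "norm x \<le> 1" for x
        using that by (auto simp: not_less)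
      have "norm v \<le> c"
      proof (rule norm_blinfun_bound[OF c(1)])
        fix x :: 'a
        show "norm (blinfun_apply v x) \<le> c * norm x"
        proof (cases "x = 0")
          case False
          have "blinfun_apply v ((1 / norm x) *\<^sub>R x) \<le> c" "blinfun_apply v ((- 1 / norm x) *\<^sub>R x) \<le> c"
            using False by (auto intro!: le)
          then show ?thesis
            using False by (simp add: blinfun.scaleR_right blinfun.minus_right field_simps)
        qed (simp add: blinfun.zero_right)
      qed
      with v c(2) show False by simp
    qed
  qed
  ultimately obtain X where X: "X \<subseteq> cball 0 1" "finite X" "?S \<subseteq> (\<Union>x\<in>X. ?U x)"
    by (rule compactE_image[of ?S "cball 0 1" ?U])
  show ?thesis
  proof (intro exI[of _ X] conjI allI impI)
    fix a :: "nat \<Rightarrow> real" assume nz: "(\<Sum>i<m. a i *\<^sub>R f i) \<noteq> 0"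
    let ?v = "\<Sum>i<m. a i *\<^sub>R f i"
    let ?w = "(1 / norm ?v) *\<^sub>R ?v"
    have w: "?w = (\<Sum>i<m. (a i / norm ?v) *\<^sub>R f i)"
      by (simp add: scaleR_sum_right)
    have nw: "norm ?w = 1" using nz by simp
    have "\<bar>a i / norm ?v\<bar> \<le> 2 * real m" if "i < m" for i
      using slow_basic_coefficient[OF f that, of "\<lambda>i. a i / norm ?v"] nw unfolding w by simp
    then have "?w \<in> ?S" using nw w by auto
    then obtain x where "x \<in> X" "c < blinfun_apply ?w x" using X(3) by blast
    then show "\<exists>x\<in>X. c * norm ?v < blinfun_apply ?v x"
      using nz by (intro bexI[of _ x]) (simp_all add: blinfun.scaleR_left field_simps)
  qed (use X(1,2) in auto)
qed

text \<open>Mazur's construction. If \<open>g\<close> vanishes on a finite set that norms the span of the previous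
  functionals up to the factor \<open>m / (m + 1)\<close>, adding a multiple of \<open>g\<close> to an element of this span
  cannot lower its norm by more than that factor.\<close>

lemma slow_basic_exists:
  assumes inf: "\<nexists>X. finite X \<and> (UNIV :: 'a::real_normed_vector set) \<subseteq> span X"
  shows "\<exists>f :: nat \<Rightarrow> 'a \<Rightarrow>\<^sub>L real. slow_basic f m"
proof (induction m)
  case (Suc m)
  then obtain f :: "nat \<Rightarrow> 'a \<Rightarrow>\<^sub>L real" where f: "slow_basic f m" by blast
  define c where "c = real m / (real m + 1)"
  have c: "0 \<le> c" "c < 1" by (auto simp: c_def)
  obtain X where X: "finite X" "\<forall>x\<in>X. norm x \<le> 1"
    "\<forall>a. (\<Sum>i<m. a i *\<^sub>R f i) \<noteq> 0 \<longrightarrow>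
       (\<exists>x\<in>X. c * norm (\<Sum>i<m. a i *\<^sub>R f i) < blinfun_apply (\<Sum>i<m. a i *\<^sub>R f i) x)"
    using finite_norming_set[OF f c] by (elim exE conjE)
  obtain g :: "'a \<Rightarrow>\<^sub>L real" where g: "norm g = 1" "\<And>x. x \<in> X \<Longrightarrow> blinfun_apply g x = 0"
    using annihilating_unit_functional[OF inf X(1)] by blast
  have key: "real m * norm (\<Sum>i<m. a i *\<^sub>R f i) \<le> (real m + 1) * norm ((\<Sum>i<m. a i *\<^sub>R f i) + t *\<^sub>R g)"
    for a t
  proof (cases "(\<Sum>i<m. a i *\<^sub>R f i) = 0")
    case False
    let ?v = "\<Sum>i<m. a i *\<^sub>R f i"
    obtain x where x: "x \<in> X" "c * norm ?v < blinfun_apply ?v x" using X(3)[rule_format, OF False] by blast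
    have "blinfun_apply ?v x = blinfun_apply (?v + t *\<^sub>R g) x"
      using g(2)[OF x(1)] by (simp add: blinfun.add_left blinfun.scaleR_left)
    also have "\<dots> \<le> norm (?v + t *\<^sub>R g) * norm x"
      using norm_blinfun[of "?v + t *\<^sub>R g" x] by simp
    also have "\<dots> \<le> norm (?v + t *\<^sub>R g)"
      using X(2)[rule_format, OF x(1)] by (simp add: mult_left_le)
    finally have "c * norm ?v \<le> norm (?v + t *\<^sub>R g)" using x(2) by simp
    then show ?thesis unfolding c_def by (simp add: field_simps)
  qed simp
  let ?f = "f(m := g)"
  have sums: "(\<Sum>i<k. a i *\<^sub>R ?f i) = (\<Sum>i<k. a i *\<^sub>R f i)" if "k \<le> m" for a k
    using that by (intro sum.cong) auto
  have "slow_basic ?f (Suc m)"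
    unfolding slow_basic_def
  proof (intro conjI allI impI)
    fix i assume "i < Suc m"
    then show "norm (?f i) = 1" using f g(1) by (auto simp: slow_basic_def)
  next
    fix a :: "nat \<Rightarrow> real" and k assume "k < Suc m"
    then consider "k = m" | "k < m" by linarith
    then show "real k * norm (\<Sum>i<k. a i *\<^sub>R ?f i) \<le> (real k + 1) * norm (\<Sum>i<Suc k. a i *\<^sub>R ?f i)"
    proof cases
      case 1
      then show ?thesis using key[of a "a m"] sums[of m a] by simp
    next
      case 2
      then show ?thesis using f sums[of k a] sums[of "Suc k" a] unfolding slow_basic_def by auto
    qed
  qed
  then show ?case by blast
qed (simp add: slow_basic_def)

section \<open>A Dvoretzky--Rogers lemma in the dual\<close>

lemma householder_isometry:
  fixes I :: "'i set" and v z :: "'i \<Rightarrow> real"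
  defines "s \<equiv> \<Sum>i\<in>I. (v i)\<^sup>2"
  assumes "s \<noteq> 0"
  shows "(\<Sum>i\<in>I. (z i - 2 * (\<Sum>l\<in>I. v l * z l) / s * v i)\<^sup>2) = (\<Sum>i\<in>I. (z i)\<^sup>2)"
proof -
  let ?d = "\<Sum>l\<in>I. v l * z l"
  let ?c = "2 * ?d / s"
  have "(\<Sum>i\<in>I. (z i - ?c * v i)\<^sup>2) = (\<Sum>i\<in>I. (z i)\<^sup>2 - 2 * ?c * (v i * z i) + ?c\<^sup>2 * (v i)\<^sup>2)"
    by (intro sum.cong) (auto simp: power2_eq_square algebra_simps)
  also have "\<dots> = (\<Sum>i\<in>I. (z i)\<^sup>2) - 2 * ?c * ?d + ?c\<^sup>2 * s"
    by (simp only: sum.distrib sum_subtractf sum_distrib_left[symmetric] s_def)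
  also have "2 * ?c * ?d = ?c\<^sup>2 * s"
    using assms(2) by (simp add: power2_eq_square)
  finally show ?thesis by simp
qed

text \<open>A family \<open>h\<close> is viewed as the map sending a coefficient vector \<open>b\<close> to \<open>\<Sum> b\<^sub>i h\<^sub>i\<close>. By
  Cauchy--Schwarz, \<open>upper_l2\<close> with constant \<open>q\<close> bounds the squared norm of this map on Euclidean
  space by \<open>q\<close>; \<open>lower_l2\<close> bounds it from below.\<close>

definition upper_l2 :: "'i set \<Rightarrow> ('i \<Rightarrow> 'a::real_normed_vector \<Rightarrow>\<^sub>L real) \<Rightarrow> real \<Rightarrow> bool" where
  "upper_l2 I h q \<longleftrightarrow> (\<forall>x. (\<Sum>i\<in>I. (blinfun_apply (h i) x)\<^sup>2) \<le> q * (norm x)\<^sup>2)"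

definition lower_l2 :: "'i set \<Rightarrow> ('i \<Rightarrow> 'v::real_normed_vector) \<Rightarrow> real \<Rightarrow> bool" where
  "lower_l2 I h c \<longleftrightarrow> (\<forall>b. c * (\<Sum>i\<in>I. (b i)\<^sup>2) \<le> (norm (\<Sum>i\<in>I. b i *\<^sub>R h i))\<^sup>2)"

text \<open>Both quadratic bounds are invariant under an orthogonal change of coefficients, and the
  Householder reflection along \<open>a - e\<^sub>j\<close> exchanges the unit vectors \<open>a\<close> and \<open>e\<^sub>j\<close>.\<close>

lemma rotate_to_combination:
  fixes h :: "'i \<Rightarrow> 'a::real_normed_vector \<Rightarrow>\<^sub>L real"
  assumes I: "finite I" "j \<in> I" and a: "(\<Sum>i\<in>I. (a i)\<^sup>2) = 1"
  obtains h' where "h' j = (\<Sum>i\<in>I. a i *\<^sub>R h i)"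
    "\<And>x. (\<Sum>i\<in>I. (blinfun_apply (h' i) x)\<^sup>2) = (\<Sum>i\<in>I. (blinfun_apply (h i) x)\<^sup>2)"
    "\<And>c. lower_l2 I h c \<Longrightarrow> lower_l2 I h' c"
proof -
  define e :: "'i \<Rightarrow> real" where "e i = (if i = j then 1 else 0)" for i
  have sum_e: "(\<Sum>i\<in>I. e i * b i) = b j" for b
  proof -
    have "(\<Sum>i\<in>I. e i * b i) = (\<Sum>i\<in>I. if i = j then b i else 0)"
      by (intro sum.cong) (auto simp: e_def)
    then show ?thesis using I by simp
  qed
  define v where "v i = a i - e i" for i
  define s where "s = (\<Sum>i\<in>I. (v i)\<^sup>2)"
  have "s = (\<Sum>i\<in>I. (a i)\<^sup>2 - 2 * (e i * a i) + e i * e i)"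
    unfolding s_def v_def by (intro sum.cong) (auto simp: power2_eq_square algebra_simps)
  also have "\<dots> = 2 - 2 * a j"
    by (simp only: sum.distrib sum_subtractf sum_distrib_left[symmetric] sum_e a) (simp add: e_def)
  finally have s: "s = 2 - 2 * a j" .
  define w where "w = (\<Sum>i\<in>I. v i *\<^sub>R h i)"
  have w: "w = (\<Sum>i\<in>I. a i *\<^sub>R h i) - h j"
  proof -
    have "(\<Sum>i\<in>I. e i *\<^sub>R h i) = (\<Sum>i\<in>I. if i = j then h i else 0)"
      by (intro sum.cong) (auto simp: e_def)
    also have "\<dots> = h j" using I by simp
    finally show ?thesis by (simp add: w_def v_def scaleR_diff_left sum_subtractf)
  qed
  show thesis
  proof (cases "s = 0")
    case True
    then have "v i = 0" if "i \<in> I" for i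
      using I(1) that by (simp add: s_def sum_nonneg_eq_0_iff)
    then have "w = 0" by (simp add: w_def)
    then show thesis using w by (intro that[of h]) auto
  next
    case False
    \<comment> \<open>The reflection sends the coefficient vector \<open>z\<close> to \<open>z - (2 \<langle>v,z\<rangle> / s) v\<close>.\<close>
    define h' where "h' i = h i - (2 * v i / s) *\<^sub>R w" for i
    show thesis
    proof (rule that[of h'])
      have "2 * v j / s = - 1"
        using False s by (simp add: v_def e_def field_simps)
      then show "h' j = (\<Sum>i\<in>I. a i *\<^sub>R h i)" by (simp add: h'_def w)
    next
      fix x
      have "blinfun_apply w x = (\<Sum>l\<in>I. v l * blinfun_apply (h l) x)"
        by (simp add: w_def blinfun.sum_left blinfun.scaleR_left)
      then have "blinfun_apply (h' i) x = blinfun_apply (h i) x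
          - 2 * (\<Sum>l\<in>I. v l * blinfun_apply (h l) x) / s * v i" for i
        by (simp add: h'_def blinfun.diff_left blinfun.scaleR_left)
      then show "(\<Sum>i\<in>I. (blinfun_apply (h' i) x)\<^sup>2) = (\<Sum>i\<in>I. (blinfun_apply (h i) x)\<^sup>2)"
        using householder_isometry[of v I "\<lambda>i. blinfun_apply (h i) x"] False
        unfolding s_def by simp
    next
      fix c assume low: "lower_l2 I h c"
      show "lower_l2 I h' c"
        unfolding lower_l2_def
      proof
        fix b :: "'i \<Rightarrow> real"
        let ?d = "\<Sum>l\<in>I. v l * b l"
        let ?b = "\<lambda>i. b i - 2 * ?d / s * v i"
        have "(\<Sum>i\<in>I. b i *\<^sub>R h' i) = (\<Sum>i\<in>I. b i *\<^sub>R h i) - (\<Sum>i\<in>I. (b i * (2 * v i / s)) *\<^sub>R w)"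
          by (simp add: h'_def scaleR_diff_right sum_subtractf)
        also have "(\<Sum>i\<in>I. (b i * (2 * v i / s)) *\<^sub>R w) = (2 * ?d / s) *\<^sub>R w"
        proof -
          have "(\<Sum>i\<in>I. b i * (2 * v i / s)) = 2 * ?d / s"
            unfolding sum_distrib_left sum_divide_distrib by (intro sum.cong) auto
          then show ?thesis by (simp only: scaleR_sum_left[symmetric])
        qed
        also have "\<dots> = (\<Sum>i\<in>I. (2 * ?d / s * v i) *\<^sub>R h i)"
          by (simp add: w_def scaleR_sum_right)
        finally have "(\<Sum>i\<in>I. b i *\<^sub>R h' i) = (\<Sum>i\<in>I. ?b i *\<^sub>R h i)"
          by (simp add: scaleR_diff_left sum_subtractf)
        moreover have "(\<Sum>i\<in>I. (?b i)\<^sup>2) = (\<Sum>i\<in>I. (b i)\<^sup>2)"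
          using householder_isometry[of v I b] False unfolding s_def by simp
        moreover have "c * (\<Sum>i\<in>I. (?b i)\<^sup>2) \<le> (norm (\<Sum>i\<in>I. ?b i *\<^sub>R h i))\<^sup>2"
          by (rule low[unfolded lower_l2_def, rule_format])
        ultimately show "c * (\<Sum>i\<in>I. (b i)\<^sup>2) \<le> (norm (\<Sum>i\<in>I. b i *\<^sub>R h' i))\<^sup>2"
          by (simp only:)
      qed
    qed
  qed
qed

text \<open>If the upper bound fails at \<open>x\<close>, the normalized values \<open>h\<^sub>i(x)\<close> are coefficients of a functional
  that is large at \<open>x\<close>.\<close>

lemma large_combination:
  fixes h :: "'i \<Rightarrow> 'a::real_normed_vector \<Rightarrow>\<^sub>L real"
  assumes "\<not> upper_l2 I h q" "q \<ge> 0"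
  obtains a where "(\<Sum>i\<in>I. (a i)\<^sup>2) = 1" "q \<le> (norm (\<Sum>i\<in>I. a i *\<^sub>R h i))\<^sup>2"
proof -
  obtain x where x: "q * (norm x)\<^sup>2 < (\<Sum>i\<in>I. (blinfun_apply (h i) x)\<^sup>2)"
    using assms(1) by (auto simp: upper_l2_def not_le)
  define S where "S = (\<Sum>i\<in>I. (blinfun_apply (h i) x)\<^sup>2)"
  have S: "S > 0" using x assms(2) unfolding S_def by (smt (verit) mult_nonneg_nonneg zero_le_power2)
  define a where "a i = blinfun_apply (h i) x / sqrt S" for i
  let ?g = "\<Sum>i\<in>I. a i *\<^sub>R h i"
  have "(\<Sum>i\<in>I. (a i)\<^sup>2) = S / S"
    unfolding a_def using S by (simp add: power_divide sum_divide_distrib[symmetric] S_def[symmetric])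
  then have a: "(\<Sum>i\<in>I. (a i)\<^sup>2) = 1" using S by simp
  have "blinfun_apply ?g x = (\<Sum>i\<in>I. (blinfun_apply (h i) x)\<^sup>2) / sqrt S"
    by (simp add: blinfun.sum_left blinfun.scaleR_left a_def power2_eq_square sum_divide_distrib)
  then have "blinfun_apply ?g x = S / sqrt S" by (simp only: S_def[symmetric])
  then have "(blinfun_apply ?g x)\<^sup>2 = S"
    using S by (simp only: power_divide) (simp add: power2_eq_square)
  moreover have "(blinfun_apply ?g x)\<^sup>2 \<le> (norm ?g * norm x)\<^sup>2"
    using norm_blinfun[of ?g x] by (intro abs_le_square_iff[THEN iffD1]) (simp add: abs_mult)
  ultimately have "q * (norm x)\<^sup>2 < (norm ?g)\<^sup>2 * (norm x)\<^sup>2"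
    using x by (simp add: S_def power_mult_distrib)
  then have "q \<le> (norm ?g)\<^sup>2" by (meson mult_right_less_imp_less less_imp_le zero_le_power2)
  with a show thesis by (rule that)
qed

text \<open>As long as the upper bound \<open>q\<close> fails, some unit combination is large; it is rotated into a single
  member of the family, which is removed. After \<open>N\<close> successful removals the removed members form
  the first alternative; if the upper bound is reached before that, the remaining family gives the
  second one.\<close>

lemma extract_or_shrink:
  fixes h :: "'i \<Rightarrow> 'a::real_normed_vector \<Rightarrow>\<^sub>L real"
  assumes "finite I" "q \<ge> 0" "lower_l2 I h c"
  shows "(\<exists>g :: nat \<Rightarrow> 'a \<Rightarrow>\<^sub>L real. (\<forall>k<N. q \<le> (norm (g k))\<^sup>2)
            \<and> (\<forall>x. (\<Sum>k<N. (blinfun_apply (g k) x)\<^sup>2) \<le> (\<Sum>i\<in>I. (blinfun_apply (h i) x)\<^sup>2)))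
       \<or> (\<exists>I' h'. I' \<subseteq> I \<and> card I \<le> card I' + N \<and> upper_l2 I' (h' :: 'i \<Rightarrow> 'a \<Rightarrow>\<^sub>L real) q \<and> lower_l2 I' h' c)"
  using assms
proof (induction N arbitrary: I h)
  case 0
  show ?case by (intro disjI1) (auto intro: sum_nonneg)
next
  case (Suc N)
  show ?case
  proof (cases "upper_l2 I h q")
    case True
    then show ?thesis using Suc.prems by (intro disjI2 exI[of _ I] exI[of _ h]) auto
  next
    case False
    then obtain a where a: "(\<Sum>i\<in>I. (a i)\<^sup>2) = 1" "q \<le> (norm (\<Sum>i\<in>I. a i *\<^sub>R h i))\<^sup>2"
      using large_combination Suc.prems(2) by blast
    then have "I \<noteq> {}" by auto
    then obtain j where j: "j \<in> I" by blast
    obtain h' where h': "h' j = (\<Sum>i\<in>I. a i *\<^sub>R h i)"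
      "\<And>x. (\<Sum>i\<in>I. (blinfun_apply (h' i) x)\<^sup>2) = (\<Sum>i\<in>I. (blinfun_apply (h i) x)\<^sup>2)"
      "lower_l2 I h' c"
      by (rule rotate_to_combination[OF Suc.prems(1) j a(1), of h]) (use Suc.prems(3) in blast)
    let ?J = "I - {j}"
    have split: "(\<Sum>i\<in>I. F i) = F j + (\<Sum>i\<in>?J. F i)" for F :: "'i \<Rightarrow> 'z::comm_monoid_add"
      using Suc.prems(1) j by (rule sum.remove)
    have "lower_l2 ?J h' c"
      unfolding lower_l2_def
    proof
      fix b :: "'i \<Rightarrow> real"
      let ?b = "b(j := 0)"
      have "(\<Sum>i\<in>?J. (?b i)\<^sup>2) = (\<Sum>i\<in>?J. (b i)\<^sup>2)" "(\<Sum>i\<in>?J. ?b i *\<^sub>R h' i) = (\<Sum>i\<in>?J. b i *\<^sub>R h' i)"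
        by (intro sum.cong; simp)+
      then have "(\<Sum>i\<in>I. (?b i)\<^sup>2) = (\<Sum>i\<in>?J. (b i)\<^sup>2)" "(\<Sum>i\<in>I. ?b i *\<^sub>R h' i) = (\<Sum>i\<in>?J. b i *\<^sub>R h' i)"
        by (simp_all add: split)
      moreover have "c * (\<Sum>i\<in>I. (?b i)\<^sup>2) \<le> (norm (\<Sum>i\<in>I. ?b i *\<^sub>R h' i))\<^sup>2"
        by (rule h'(3)[unfolded lower_l2_def, rule_format])
      ultimately show "c * (\<Sum>i\<in>?J. (b i)\<^sup>2) \<le> (norm (\<Sum>i\<in>?J. b i *\<^sub>R h' i))\<^sup>2"
        by (simp only:)
    qed
    note IH = Suc.IH[of ?J h', OF _ Suc.prems(2) this]
    show ?thesis
    proof (rule disjE[OF IH])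
      show "finite ?J" using Suc.prems(1) by simp
    next
      assume "\<exists>g :: nat \<Rightarrow> 'a \<Rightarrow>\<^sub>L real. (\<forall>k<N. q \<le> (norm (g k))\<^sup>2)
            \<and> (\<forall>x. (\<Sum>k<N. (blinfun_apply (g k) x)\<^sup>2) \<le> (\<Sum>i\<in>?J. (blinfun_apply (h' i) x)\<^sup>2))"
      then obtain g :: "nat \<Rightarrow> 'a \<Rightarrow>\<^sub>L real" where g: "\<And>k. k < N \<Longrightarrow> q \<le> (norm (g k))\<^sup>2"
        "\<And>x. (\<Sum>k<N. (blinfun_apply (g k) x)\<^sup>2) \<le> (\<Sum>i\<in>?J. (blinfun_apply (h' i) x)\<^sup>2)" by blast
      let ?g = "g(N := h' j)"
      have "(\<Sum>k<Suc N. (blinfun_apply (?g k) x)\<^sup>2) \<le> (\<Sum>i\<in>I. (blinfun_apply (h i) x)\<^sup>2)" for x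
        using g(2)[of x] by (simp add: h'(2)[symmetric] split)
      moreover have "q \<le> (norm (?g k))\<^sup>2" if "k < Suc N" for k
        using that g(1) a(2) by (auto simp: less_Suc_eq h'(1))
      ultimately show ?thesis by blast
    next
      assume "\<exists>I' h'. I' \<subseteq> ?J \<and> card ?J \<le> card I' + N \<and> upper_l2 I' (h' :: 'i \<Rightarrow> 'a \<Rightarrow>\<^sub>L real) q \<and> lower_l2 I' h' c"
      then obtain I' and h'' :: "'i \<Rightarrow> 'a \<Rightarrow>\<^sub>L real" where
        *: "I' \<subseteq> ?J" "card ?J \<le> card I' + N" "upper_l2 I' h'' q" "lower_l2 I' h'' c" by blast
      have "card I \<le> card I' + Suc N"
        using *(2) card_Suc_Diff1[OF Suc.prems(1) j] by linarith
      then show ?thesis using * by blast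
    qed
  qed
qed

text \<open>Suppose that the extraction fails for every family. Then the upper constant of a family can be
  halved again and again at the price of \<open>N\<close> members each time, while the lower constant stays. A
  slow basic family of size \<open>n = K N + 1\<close> has upper constant \<open>n\<close> and lower constant
  \<open>1 / (4 n\<^sup>3)\<close>, and it survives \<open>K\<close> rounds with a member left; hence \<open>1 / (4 n\<^sup>3) \<le> n / 2\<^sup>K\<close>, which is
  false for large \<open>K\<close>.\<close>

theorem dvoretzky_rogers:
  fixes N :: nat
  assumes inf: "\<nexists>X. finite X \<and> (UNIV :: 'a::real_normed_vector set) \<subseteq> span X"
  obtains g :: "nat \<Rightarrow> 'a::real_normed_vector \<Rightarrow>\<^sub>L real" where "\<And>k. k < N \<Longrightarrow> 1 / 2 \<le> (norm (g k))\<^sup>2"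
    "\<And>x. (\<Sum>k<N. (blinfun_apply (g k) x)\<^sup>2) \<le> (norm x)\<^sup>2"
proof (rule ccontr)
  assume "\<not> thesis"
  with that have none: False if "\<forall>k<N. 1 / 2 \<le> (norm (g k))\<^sup>2"
    "\<forall>x. (\<Sum>k<N. (blinfun_apply (g k) x)\<^sup>2) \<le> (norm x)\<^sup>2" for g :: "nat \<Rightarrow> 'a \<Rightarrow>\<^sub>L real"
    using that by blast
  have shrink: "\<exists>I' h'. I' \<subseteq> I \<and> card I \<le> card I' + N \<and> upper_l2 I' (h' :: nat \<Rightarrow> 'a \<Rightarrow>\<^sub>L real) (q / 2) \<and> lower_l2 I' h' c"
    if "finite I" "q > 0" "lower_l2 I h c" "upper_l2 I h q" for I q c and h :: "nat \<Rightarrow> 'a \<Rightarrow>\<^sub>L real"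
  proof -
    have False if g: "\<forall>k<N. q / 2 \<le> (norm (g k))\<^sup>2"
      "\<forall>x. (\<Sum>k<N. (blinfun_apply (g k) x)\<^sup>2) \<le> (\<Sum>i\<in>I. (blinfun_apply (h i) x)\<^sup>2)"
      for g :: "nat \<Rightarrow> 'a \<Rightarrow>\<^sub>L real"
    proof (rule none[of "\<lambda>k. (1 / sqrt q) *\<^sub>R g k"])
      show "\<forall>k<N. 1 / 2 \<le> (norm ((1 / sqrt q) *\<^sub>R g k))\<^sup>2"
        using g(1) \<open>q > 0\<close> by (auto simp: power_divide field_simps)
      have "(\<Sum>k<N. (blinfun_apply (g k) x)\<^sup>2) \<le> q * (norm x)\<^sup>2" for x
        using g(2) \<open>upper_l2 I h q\<close> unfolding upper_l2_def by (meson order_trans)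
      then show "\<forall>x. (\<Sum>k<N. (blinfun_apply ((1 / sqrt q) *\<^sub>R g k) x)\<^sup>2) \<le> (norm x)\<^sup>2"
        using \<open>q > 0\<close>
        by (auto simp: blinfun.scaleR_left power_divide sum_divide_distrib[symmetric] field_simps)
    qed
    then show ?thesis
      using extract_or_shrink[OF \<open>finite I\<close> _ \<open>lower_l2 I h c\<close>, of "q / 2" N] \<open>q > 0\<close> by auto
  qed
  have "(\<lambda>k. 4 * (real k + 1) ^ 4 / 2 ^ k) \<longlonglongrightarrow> 0" by real_asymp
  then have "\<forall>\<^sub>F k in sequentially. 4 * (real k + 1) ^ 4 / 2 ^ k < 1 / (real N + 1) ^ 4"
    by (rule order_tendstoD) simp
  then obtain K where "4 * (real K + 1) ^ 4 / 2 ^ K < 1 / (real N + 1) ^ 4"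
    by (auto simp: eventually_sequentially)
  then have "4 * ((real K + 1) * (real N + 1)) ^ 4 / 2 ^ K < 1"
    by (simp only: power_mult_distrib) (simp add: field_simps)
  moreover have "real (K * N + 1) ^ 4 \<le> ((real K + 1) * (real N + 1)) ^ 4"
    by (intro power_mono) (auto simp: algebra_simps)
  then have "4 * real (K * N + 1) ^ 4 / 2 ^ K \<le> 4 * ((real K + 1) * (real N + 1)) ^ 4 / 2 ^ K"
    by (intro divide_right_mono mult_left_mono) auto
  ultimately have K: "4 * real (K * N + 1) ^ 4 / 2 ^ K < 1" by linarith
  define n where "n = K * N + 1"
  obtain f :: "nat \<Rightarrow> 'a \<Rightarrow>\<^sub>L real" where f: "slow_basic f n" using slow_basic_exists[OF inf] by blast
  define c where "c = 1 / (4 * real n ^ 3)"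
  have n: "real n \<ge> 1" by (simp add: n_def)
  have low: "lower_l2 {..<n} f c"
    unfolding lower_l2_def
  proof
    fix b :: "nat \<Rightarrow> real"
    let ?v = "\<Sum>i<n. b i *\<^sub>R f i"
    have "(\<Sum>i<n. (b i)\<^sup>2) \<le> (\<Sum>i<n. (2 * real n * norm ?v)\<^sup>2)"
      using slow_basic_coefficient[OF f] by (intro sum_mono abs_le_square_iff[THEN iffD1]) (simp add: abs_mult)
    also have "\<dots> = 4 * real n ^ 3 * (norm ?v)\<^sup>2"
      by (simp add: power2_eq_square power3_eq_cube)
    finally show "c * (\<Sum>i<n. (b i)\<^sup>2) \<le> (norm ?v)\<^sup>2"
      unfolding c_def using n by (simp add: field_simps)
  qed
  have up: "upper_l2 {..<n} f (real n)"
    unfolding upper_l2_def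
  proof
    fix x :: 'a
    have "(\<Sum>i<n. (blinfun_apply (f i) x)\<^sup>2) \<le> (\<Sum>i<n. (norm x)\<^sup>2)"
    proof (rule sum_mono)
      fix i assume "i \<in> {..<n}"
      then have "norm (f i) = 1" using f by (auto simp: slow_basic_def)
      then show "(blinfun_apply (f i) x)\<^sup>2 \<le> (norm x)\<^sup>2"
        using norm_blinfun[of "f i" x] by (intro abs_le_square_iff[THEN iffD1]) simp
    qed
    then show "(\<Sum>i<n. (blinfun_apply (f i) x)\<^sup>2) \<le> real n * (norm x)\<^sup>2" by simp
  qed
  \<comment> \<open>After \<open>k\<close> rounds at most \<open>k N\<close> members have been lost.\<close>
  have "\<exists>I h. finite I \<and> n \<le> card I + k * N \<and> upper_l2 I (h :: nat \<Rightarrow> 'a \<Rightarrow>\<^sub>L real) (real n / 2 ^ k) \<and> lower_l2 I h c" for k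
  proof (induction k)
    case 0
    show ?case using low up by (intro exI[of _ "{..<n}"] exI[of _ f]) auto
  next
    case (Suc k)
    then obtain I and h :: "nat \<Rightarrow> 'a \<Rightarrow>\<^sub>L real" where
      *: "finite I" "n \<le> card I + k * N" "upper_l2 I h (real n / 2 ^ k)" "lower_l2 I h c" by blast
    obtain I' and h' :: "nat \<Rightarrow> 'a \<Rightarrow>\<^sub>L real" where
      **: "I' \<subseteq> I" "card I \<le> card I' + N" "upper_l2 I' h' (real n / 2 ^ k / 2)" "lower_l2 I' h' c"
      using shrink[OF *(1) _ *(4,3)] n by auto
    then show ?case using *(1,2) finite_subset by (intro exI[of _ I'] exI[of _ h']) (auto simp: mult.commute)
  qed
  then obtain I and h :: "nat \<Rightarrow> 'a \<Rightarrow>\<^sub>L real" where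
    *: "finite I" "n \<le> card I + K * N" "upper_l2 I h (real n / 2 ^ K)" "lower_l2 I h c" by blast
  then have "I \<noteq> {}" by (auto simp: n_def)
  then obtain j where j: "j \<in> I" by blast
  define e :: "nat \<Rightarrow> real" where "e i = (if i = j then 1 else 0)" for i
  have "(\<Sum>i\<in>I. (e i)\<^sup>2) = 1" "(\<Sum>i\<in>I. e i *\<^sub>R h i) = h j"
    using *(1) j by (simp_all add: e_def if_distrib[of "\<lambda>t. t *\<^sub>R _"] if_distrib[of "\<lambda>t. t\<^sup>2"] cong: if_cong)
  then have "c \<le> (norm (h j))\<^sup>2"
    using *(4)[unfolded lower_l2_def, rule_format, of e] by simp
  moreover have "norm (h j) \<le> sqrt (real n / 2 ^ K)"
  proof (rule norm_blinfun_bound)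
    fix x
    have "(blinfun_apply (h j) x)\<^sup>2 \<le> (\<Sum>i\<in>I. (blinfun_apply (h i) x)\<^sup>2)"
      using *(1) j by (intro member_le_sum) auto
    also have "\<dots> \<le> (sqrt (real n / 2 ^ K) * norm x)\<^sup>2"
      using *(3) unfolding upper_l2_def by (simp add: power_mult_distrib)
    finally show "norm (blinfun_apply (h j) x) \<le> sqrt (real n / 2 ^ K) * norm x"
      by (simp add: abs_le_square_iff[symmetric] abs_mult)
  qed simp
  then have "(norm (h j))\<^sup>2 \<le> (sqrt (real n / 2 ^ K))\<^sup>2" by (intro power_mono) auto
  ultimately have "c \<le> real n / 2 ^ K" by simp
  then have "1 \<le> 4 * real n ^ 4 / 2 ^ K"
  proof -
    have "1 = 4 * real n ^ 3 * c" unfolding c_def using n by simp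
    also have "\<dots> \<le> 4 * real n ^ 3 * (real n / 2 ^ K)"
      using \<open>c \<le> real n / 2 ^ K\<close> by (intro mult_left_mono) auto
    also have "\<dots> = 4 * real n ^ 4 / 2 ^ K" by (simp add: eval_nat_numeral)
    finally show ?thesis .
  qed
  with K show False unfolding n_def by simp
qed

section \<open>Uniform boundedness in barrelled spaces\<close>

text \<open>The barrel is the polar of all functionals \<open>x \<mapsto> f\<^sub>n(c x)\<close> with \<open>\<parallel>c\<parallel> \<le> 1\<close>, so that it is absolutely
  convex over the scalar field although the \<open>f\<^sub>n\<close> are only real-linear. It is absorbing because the
  scalars are real combinations of \<open>1\<close> and \<open>j\<close> with controlled coefficients: boundedness of
  \<open>f\<^sub>n(x)\<close> and \<open>f\<^sub>n(j x)\<close> bounds all of them. The cases of interest are \<open>j = 0\<close> for real and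
  \<open>j = \<i>\<close> for complex scalars.\<close>

lemma barrelled_uniform_boundedness:
  fixes sc :: "'k::real_normed_field \<Rightarrow> 'a::real_normed_vector \<Rightarrow> 'a"
    and f :: "nat \<Rightarrow> 'a \<Rightarrow>\<^sub>L real"
  assumes "normed_barrelled_space sc"
    and coords: "\<And>c :: 'k. \<exists>s t. \<bar>s\<bar> \<le> norm c \<and> \<bar>t\<bar> \<le> norm c \<and> c = of_real s + of_real t * j"
    and pointwise: "\<And>x. \<exists>C. \<forall>n. \<bar>blinfun_apply (f n) x\<bar> \<le> C"
  shows "\<exists>C. \<forall>n. norm (f n) \<le> C"
proof -
  interpret V: normed_barrelled_space sc by fact
  have sc_scaleR: "sc c (u *\<^sub>R x) = u *\<^sub>R sc c x" for c u x
    by (simp add: V.scale_of_real[symmetric] mult.commute)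
  have bl: "bounded_linear (sc c)" for c
    by (intro bounded_linear_intro[of _ "norm c"])
      (auto simp: V.scale_right_distrib sc_scaleR V.norm_scale mult.commute)
  define T where "T = {x. \<forall>n c. norm c \<le> 1 \<longrightarrow> \<bar>blinfun_apply (f n) (sc c x)\<bar> \<le> 1}"
  have "convex T"
  proof (rule convexI)
    fix x y and u v :: real
    assume T: "x \<in> T" "y \<in> T" and uv: "0 \<le> u" "0 \<le> v" "u + v = 1"
    have "\<bar>blinfun_apply (f n) (sc c (u *\<^sub>R x + v *\<^sub>R y))\<bar> \<le> 1" if "norm c \<le> 1" for n c
    proof -
      let ?a = "blinfun_apply (f n) (sc c x)" and ?b = "blinfun_apply (f n) (sc c y)"
      have ab: "\<bar>?a\<bar> \<le> 1" "\<bar>?b\<bar> \<le> 1" using T that by (auto simp: T_def)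
      have "blinfun_apply (f n) (sc c (u *\<^sub>R x + v *\<^sub>R y)) = u * ?a + v * ?b"
        by (simp add: V.scale_right_distrib sc_scaleR blinfun.add_right blinfun.scaleR_right)
      moreover have "\<bar>u * ?a + v * ?b\<bar> \<le> u * \<bar>?a\<bar> + v * \<bar>?b\<bar>"
        using uv by (metis abs_mult abs_of_nonneg abs_triangle_ineq)
      moreover have "u * \<bar>?a\<bar> + v * \<bar>?b\<bar> \<le> u * 1 + v * 1"
        using uv ab by (intro add_mono mult_left_mono) auto
      ultimately show ?thesis using uv by simp
    qed
    then show "u *\<^sub>R x + v *\<^sub>R y \<in> T" by (simp add: T_def)
  qed
  moreover have "sc d x \<in> T" if "x \<in> T" "norm d \<le> 1" for d x
  proof -
    have "norm (c * d) \<le> 1" if "norm c \<le> 1" for c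
      using that \<open>norm d \<le> 1\<close> by (simp add: norm_mult mult_le_one)
    then show ?thesis using \<open>x \<in> T\<close> by (simp add: T_def)
  qed
  ultimately have "absolutely_convex sc T" by (auto simp: absolutely_convex_def)
  moreover have "closed T"
  proof -
    have "T = (\<Inter>n. \<Inter>c\<in>{c. norm c \<le> 1}. {x. \<bar>blinfun_apply (f n) (sc c x)\<bar> \<le> 1})"
      by (auto simp: T_def)
    moreover have "closed {x. \<bar>blinfun_apply (f n) (sc c x)\<bar> \<le> 1}" for n c
      by (intro closed_Collect_le continuous_intros linear_continuous_on[OF bl])
    ultimately show ?thesis by (simp add: closed_INT)
  qed
  moreover have "absorbing sc T"
    unfolding absorbing_def
  proof
    fix x
    obtain C where C: "\<And>n. \<bar>blinfun_apply (f n) x\<bar> \<le> C" using pointwise by blast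
    obtain D where D: "\<And>n. \<bar>blinfun_apply (f n) (sc j x)\<bar> \<le> D" using pointwise by blast
    have nonneg: "0 \<le> C" "0 \<le> D" using C[of 0] D[of 0] by linarith+
    have "x \<in> sc c ` T" if c: "norm c \<ge> C + D + 1" for c
    proof (rule image_eqI)
      have c0: "c \<noteq> 0" "norm c > 0" using c nonneg by auto
      show "x = sc c (sc (inverse c) x)" using c0 by simp
      have "\<bar>blinfun_apply (f n) (sc (d * inverse c) x)\<bar> \<le> 1" if "norm d \<le> 1" for n d
      proof -
        let ?e = "d * inverse c"
        obtain s t where st: "\<bar>s\<bar> \<le> norm ?e" "\<bar>t\<bar> \<le> norm ?e" "?e = of_real s + of_real t * j"
          using coords by blast
        have e: "norm ?e \<le> 1 / norm c"
          using that c0 by (simp add: norm_divide divide_simps)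
        have "sc ?e x = s *\<^sub>R x + t *\<^sub>R sc j x"
          unfolding st(3) by (simp add: V.scale_left_distrib V.scale_of_real[symmetric])
        then have "blinfun_apply (f n) (sc ?e x)
            = s * blinfun_apply (f n) x + t * blinfun_apply (f n) (sc j x)"
          by (simp add: blinfun.add_right blinfun.scaleR_right)
        also have "\<bar>\<dots>\<bar> \<le> \<bar>s\<bar> * \<bar>blinfun_apply (f n) x\<bar> + \<bar>t\<bar> * \<bar>blinfun_apply (f n) (sc j x)\<bar>"
          by (metis abs_mult abs_triangle_ineq)
        also have "\<dots> \<le> (1 / norm c) * C + (1 / norm c) * D"
          using st e C D c0 nonneg by (intro add_mono mult_mono) auto
        also have "\<dots> \<le> 1" using c c0 nonneg by (simp add: field_simps)
        finally show ?thesis .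
      qed
      then show "sc (inverse c) x \<in> T" by (simp add: T_def)
    qed
    then show "\<exists>r>0. \<forall>c. norm c \<ge> r \<longrightarrow> x \<in> sc c ` T"
      using nonneg by (intro exI[of _ "C + D + 1"]) auto
  qed
  ultimately have "0 \<in> interior T"
    by (intro V.barrelled) (simp add: barrel_def)
  then obtain e where e: "e > 0" "ball 0 e \<subseteq> T" by (auto simp: mem_interior)
  have "norm (f n) \<le> 2 / e" for n
  proof (rule norm_blinfun_bound)
    fix x
    show "norm (blinfun_apply (f n) x) \<le> 2 / e * norm x"
    proof (cases "x = 0")
      case False
      then have "(e / (2 * norm x)) *\<^sub>R x \<in> T" using e by (intro subsetD[OF e(2)]) simp
      then have "\<bar>blinfun_apply (f n) (sc 1 ((e / (2 * norm x)) *\<^sub>R x))\<bar> \<le> 1"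
        unfolding T_def by (metis (mono_tags, lifting) mem_Collect_eq norm_one order_refl)
      then show ?thesis
        using e(1) False by (simp add: blinfun.scaleR_right abs_mult field_simps)
    qed (simp add: blinfun.zero_right)
  qed (use e in simp)
  then show ?thesis by blast
qed

section \<open>Random selections and null sets\<close>

text \<open>The index of the interval of length \<open>8\<^bsup>-n\<^esup>\<close> that contains \<open>w\<close>. The minimum puts \<open>w = 1\<close> into the
  last interval.\<close>

definition cell :: "nat \<Rightarrow> real \<Rightarrow> nat" where
  "cell n w = min (nat \<lfloor>8 ^ n * w\<rfloor>) (8 ^ n - 1)"

lemma cell_less: "cell n w < 8 ^ n"
  by (simp add: cell_def min_less_iff_disj)

lemma mem_cell:
  assumes "w \<in> {0..1}"
  shows "w \<in> {real (cell n w) / 8 ^ n..(real (cell n w) + 1) / 8 ^ n}"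
proof -
  let ?k = "nat \<lfloor>8 ^ n * w\<rfloor>"
  have k: "real ?k \<le> 8 ^ n * w" "8 ^ n * w < real ?k + 1"
    using assms by (simp_all add: floor_correct)
  have "real (cell n w) \<le> 8 ^ n * w"
    using k(1) by (rule order_trans[rotated]) (simp add: cell_def)
  moreover have "8 ^ n * w \<le> real (cell n w) + 1"
  proof (cases "?k \<le> 8 ^ n - 1")
    case False
    then have "real (cell n w) + 1 = 8 ^ n" by (simp add: cell_def min_def of_nat_diff)
    then show ?thesis using assms by simp
  qed (use k(2) in \<open>simp add: cell_def min_def\<close>)
  ultimately show ?thesis by (simp add: field_simps)
qed

text \<open>By Chebyshev's inequality at most \<open>4\<^sup>n D\<close> of the \<open>8\<^sup>n\<close> cells carry a value \<open>2\<^sup>n \<bar>u\<^sub>n\<^sub>k\<bar> > 1\<close>, so the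
  union of these cells has measure at most \<open>D / 2\<^sup>n\<close>. By Borel--Cantelli almost every \<open>w\<close> lies in
  only finitely many of these unions.\<close>

lemma unbounded_selection_null:
  fixes u :: "nat \<Rightarrow> nat \<Rightarrow> real"
  assumes u: "\<And>n. (\<Sum>k<8 ^ n. (u n k)\<^sup>2) \<le> D"
  shows "{w \<in> {0..1}. \<not> (\<exists>C. \<forall>n. \<bar>2 ^ n * u n (cell n w)\<bar> \<le> C)} \<in> null_sets lebesgue"
proof -
  define J where "J n = {k. k < 8 ^ n \<and> \<bar>2 ^ n * u n k\<bar> > 1}" for n
  define A where "A n = (\<Union>k\<in>J n. {real k / 8 ^ n..(real k + 1) / 8 ^ n})" for n
  have finJ: "finite (J n)" for n by (simp add: J_def)
  have measA: "A n \<in> fmeasurable lborel" for n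
    unfolding A_def by (intro fmeasurable.finite_UN finJ) (auto simp: fmeasurable_def emeasure_lborel_Icc_eq)
  have cardJ: "real (card (J n)) \<le> 4 ^ n * D" for n
  proof -
    have "real (card (J n)) = (\<Sum>k\<in>J n. 1)" by simp
    also have "\<dots> \<le> (\<Sum>k\<in>J n. 4 ^ n * (u n k)\<^sup>2)"
    proof (rule sum_mono)
      fix k assume "k \<in> J n"
      then have "1\<^sup>2 \<le> \<bar>2 ^ n * u n k\<bar>\<^sup>2" by (intro power_mono) (auto simp: J_def)
      also have "\<dots> = (2\<^sup>2) ^ n * (u n k)\<^sup>2"
        by (simp only: power2_abs power_mult_distrib power_mult[symmetric] mult.commute)
      finally show "1 \<le> 4 ^ n * (u n k)\<^sup>2" by simp
    qed
    also have "\<dots> \<le> (\<Sum>k<8 ^ n. 4 ^ n * (u n k)\<^sup>2)"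
      by (rule sum_mono2) (auto simp: J_def)
    also have "\<dots> \<le> 4 ^ n * D"
      using u[of n] by (simp add: sum_distrib_left[symmetric])
    finally show ?thesis .
  qed
  have measure_A: "measure lborel (A n) \<le> D * (1 / 2) ^ n" for n
  proof -
    have "measure lborel (A n) \<le> (\<Sum>k\<in>J n. measure lborel {real k / 8 ^ n..(real k + 1) / 8 ^ n})"
      unfolding A_def by (intro measure_UNION_le finJ) auto
    also have "\<dots> = real (card (J n)) / 8 ^ n"
      by (simp add: divide_right_mono diff_divide_distrib[symmetric])
    also have "\<dots> \<le> 4 ^ n * D / 8 ^ n" by (intro divide_right_mono cardJ) simp
    also have "\<dots> = D * (4 / 8) ^ n" by (simp only: power_divide) simp
    finally show ?thesis by simp
  qed
  have "limsup A \<in> null_sets lborel"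
  proof (rule borel_cantelli_limsup1)
    show "A n \<in> sets lborel" for n using measA by blast
    show "emeasure lborel (A n) < \<infinity>" for n using measA by (auto simp: fmeasurable_def)
    have "summable (\<lambda>n. D * (1 / 2 :: real) ^ n)" by (intro summable_mult summable_geometric) simp
    then show "summable (\<lambda>n. measure lborel (A n))"
      by (rule summable_comparison_test'[where N = 0]) (simp add: measure_A)
  qed
  moreover have "{w \<in> {0..1}. \<not> (\<exists>C. \<forall>n. \<bar>2 ^ n * u n (cell n w)\<bar> \<le> C)} \<subseteq> limsup A"
  proof
    fix w assume w: "w \<in> {w \<in> {0..1}. \<not> (\<exists>C. \<forall>n. \<bar>2 ^ n * u n (cell n w)\<bar> \<le> C)}"
    show "w \<in> limsup A"
    proof (rule ccontr)
      assume "w \<notin> limsup A"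
      then obtain M where M: "\<And>n. n \<ge> M \<Longrightarrow> w \<notin> A n" by (auto simp: limsup_INF_SUP)
      let ?s = "\<lambda>n. 2 ^ n * u n (cell n w)"
      have large: "\<bar>?s n\<bar> \<le> 1" if "n \<ge> M" for n
      proof (rule ccontr)
        assume "\<not> \<bar>?s n\<bar> \<le> 1"
        then have "cell n w \<in> J n" using cell_less by (simp add: J_def)
        then have "w \<in> A n" unfolding A_def using mem_cell[of w n] w by blast
        with M[OF that] show False by simp
      qed
      have "\<bar>?s n\<bar> \<le> 1 + (\<Sum>i<M. \<bar>?s i\<bar>)" for n
      proof (cases "n < M")
        case True
        then have "\<bar>?s n\<bar> \<le> (\<Sum>i<M. \<bar>?s i\<bar>)" by (intro member_le_sum) auto
        then show ?thesis by simp
      next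
        case False
        moreover have "0 \<le> (\<Sum>i<M. \<bar>?s i\<bar>)" by (intro sum_nonneg) simp
        ultimately show ?thesis using large[of n] by linarith
      qed
      with w show False by blast
    qed
  qed
  ultimately show ?thesis by (auto simp: null_sets_completion_iff2)
qed

section \<open>The dimension of barrelled spaces\<close>

text \<open>The sets \<open>Z x\<close> of points whose random sequence is unbounded at \<open>x\<close> are null, and those with
  \<open>x \<in> S\<close> cover the interval because a selection that is bounded on a spanning set is bounded
  everywhere, whereas its norms are at least \<open>2\<^sup>n / \<surd>2\<close>.\<close>

theorem cov_null_le_spanning_set:
  fixes sc :: "'k::real_normed_field \<Rightarrow> 'a::real_normed_vector \<Rightarrow> 'a" and S :: "'a set"
  assumes barrelled: "normed_barrelled_space sc"
    and coords: "\<And>c :: 'k. \<exists>s t. \<bar>s\<bar> \<le> norm c \<and> \<bar>t\<bar> \<le> norm c \<and> c = of_real s + of_real t * j"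
    and inf: "\<nexists>X. finite X \<and> (UNIV :: 'a set) \<subseteq> span X"
    and S: "span S = UNIV"
  shows "cov_null \<le>o |S|"
proof -
  have "\<exists>g :: nat \<Rightarrow> 'a \<Rightarrow>\<^sub>L real. (\<forall>k<8 ^ n. 1 / 2 \<le> (norm (g k))\<^sup>2)
      \<and> (\<forall>x. (\<Sum>k<8 ^ n. (blinfun_apply (g k) x)\<^sup>2) \<le> (norm x)\<^sup>2)" for n :: nat
    by (rule dvoretzky_rogers[OF inf, of "8 ^ n"]) blast
  then obtain g :: "nat \<Rightarrow> nat \<Rightarrow> 'a \<Rightarrow>\<^sub>L real" where
    g_norm: "\<And>n k. k < 8 ^ n \<Longrightarrow> 1 / 2 \<le> (norm (g n k))\<^sup>2" and
    g_sum: "\<And>n x. (\<Sum>k<8 ^ n. (blinfun_apply (g n k) x)\<^sup>2) \<le> (norm x)\<^sup>2"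
    by metis
  define Z where "Z x = {w \<in> {0..1}. \<not> (\<exists>C. \<forall>n. \<bar>2 ^ n * blinfun_apply (g n (cell n w)) x\<bar> \<le> C)}" for x
  have null: "Z x \<in> null_sets lebesgue" for x
    unfolding Z_def by (rule unbounded_selection_null[OF g_sum])
  have "w \<in> \<Union>(Z ` S)" if w: "w \<in> {0..1}" for w
  proof (rule ccontr)
    assume notin: "w \<notin> \<Union>(Z ` S)"
    define f where "f n = 2 ^ n *\<^sub>R g n (cell n w)" for n
    let ?P = "{x. \<exists>C. \<forall>n. \<bar>blinfun_apply (f n) x\<bar> \<le> C}"
    have "subspace ?P"
    proof (rule subspaceI)
      show "0 \<in> ?P" by (auto simp: blinfun.zero_right)
    next
      fix x y assume "x \<in> ?P" "y \<in> ?P"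
      then obtain C D where "\<And>n. \<bar>blinfun_apply (f n) x\<bar> \<le> C" "\<And>n. \<bar>blinfun_apply (f n) y\<bar> \<le> D"
        by blast
      then have "\<bar>blinfun_apply (f n) (x + y)\<bar> \<le> C + D" for n
        by (metis abs_triangle_ineq add_mono blinfun.add_right order_trans)
      then show "x + y \<in> ?P" by blast
    next
      fix c :: real and x assume "x \<in> ?P"
      then obtain C where "\<And>n. \<bar>blinfun_apply (f n) x\<bar> \<le> C" by blast
      then have "\<bar>blinfun_apply (f n) (c *\<^sub>R x)\<bar> \<le> \<bar>c\<bar> * C" for n
        by (simp add: blinfun.scaleR_right abs_mult mult_left_mono)
      then show "c *\<^sub>R x \<in> ?P" by blast
    qed
    moreover have "S \<subseteq> ?P"
      using notin w by (auto simp: Z_def f_def blinfun.scaleR_left)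
    ultimately have "span S \<subseteq> ?P" by (rule span_minimal[rotated])
    then have "\<exists>C. \<forall>n. \<bar>blinfun_apply (f n) x\<bar> \<le> C" for x using S by blast
    then obtain C where C: "\<And>n. norm (f n) \<le> C"
      using barrelled_uniform_boundedness[OF barrelled coords, of f] by blast
    obtain n where n: "2 * C\<^sup>2 < 4 ^ n" using real_arch_pow[of 4 "2 * C\<^sup>2"] by auto
    have four: "(2 ^ n :: real)\<^sup>2 = 4 ^ n"
      by (simp add: power2_eq_square power_mult_distrib[symmetric])
    have "4 ^ n * (1 / 2) \<le> 4 ^ n * (norm (g n (cell n w)))\<^sup>2"
      using g_norm[OF cell_less, of n w] by (intro mult_left_mono) auto
    also have "\<dots> = (norm (f n))\<^sup>2"
      unfolding f_def by (simp add: power_mult_distrib four)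
    also have "\<dots> \<le> C\<^sup>2" using C by (intro power_mono) auto
    finally show False using n by simp
  qed
  then have "null_cover (Z ` S)"
    using null unfolding null_cover_def by (auto simp: Z_def)
  then have "cov_null \<le>o |Z ` S|" using cov_null_spec by blast
  then show ?thesis using card_of_image ordLeq_transitive by blast
qed

text \<open>The bound for real spanning sets applies to \<open>B \<union> j B\<close> for a Hamel basis \<open>B\<close> over the given scalars: this
  set spans over the reals and has the cardinality of \<open>B\<close>, which is infinite.\<close>

theorem cov_null_le_alg_dim:
  fixes sc :: "'k::real_normed_field \<Rightarrow> 'a::real_normed_vector \<Rightarrow> 'a"
  assumes barrelled: "normed_barrelled_space sc" and inf: "cinfinite (alg_dim sc)"
    and coords: "\<And>c :: 'k. \<exists>s t. \<bar>s\<bar> \<le> norm c \<and> \<bar>t\<bar> \<le> norm c \<and> c = of_real s + of_real t * j"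
  shows "cov_null \<le>o alg_dim sc"
proof -
  interpret V: normed_barrelled_space sc by fact
  obtain B where B: "hamel_basis sc B" using hamel_basis_exists[OF V.vector_space_axioms] by blast
  have dim: "alg_dim sc =o |B|" by (rule alg_dim_eq[OF V.vector_space_axioms B])
  have ind: "\<not> V.dependent B" and spanB: "V.span B = UNIV"
    using B by (auto simp: hamel_basis_def)
  have infB: "infinite B"
    using cinfinite_mono[OF ordIso_imp_ordLeq[OF dim] inf] by (simp add: cinfinite_def Field_card_of)
  have "\<nexists>X. finite X \<and> (UNIV :: 'a set) \<subseteq> span X"
  proof
    assume "\<exists>X. finite X \<and> (UNIV :: 'a set) \<subseteq> span X"
    then obtain X :: "'a set" where X: "finite X" "UNIV \<subseteq> span X" by blast
    have "subspace (V.span X)"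
      by (auto intro!: subspaceI V.span_add V.span_zero V.span_scale simp: V.scale_of_real[symmetric])
    then have "span X \<subseteq> V.span X" by (rule span_minimal[OF V.span_superset])
    then have "B \<subseteq> V.span X" using X(2) by blast
    then show False using V.independent_span_bound[OF X(1) ind] infB by blast
  qed
  moreover have "span (B \<union> sc j ` B) = UNIV"
  proof -
    have "x \<in> span (B \<union> sc j ` B)" for x
    proof (rule V.span_induct_alt[of x B])
      show "x \<in> V.span B" using spanB by simp
      show "0 \<in> span (B \<union> sc j ` B)" by (rule span_zero)
    next
      fix c b y assume b: "b \<in> B" and y: "y \<in> span (B \<union> sc j ` B)"
      obtain s t where c: "c = of_real s + of_real t * j" using coords by blast
      have "sc c b = s *\<^sub>R b + t *\<^sub>R sc j b"
        unfolding c by (simp add: V.scale_left_distrib V.scale_of_real[symmetric])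
      then have "sc c b \<in> span (B \<union> sc j ` B)"
        using b by (auto intro!: span_add span_scale intro: span_base)
      then show "sc c b + y \<in> span (B \<union> sc j ` B)" using y by (rule span_add)
    qed
    then show ?thesis by blast
  qed
  ultimately have "cov_null \<le>o |B \<union> sc j ` B|"
    by (intro cov_null_le_spanning_set[OF barrelled coords])
  also have "|B \<union> sc j ` B| \<le>o |B|"
    using infB by (intro card_of_Un_ordLeq_infinite_Field card_of_image card_of_Card_order ordLeq_refl)
      (auto simp: Field_card_of)
  also have "|B| \<le>o alg_dim sc" by (rule ordIso_imp_ordLeq[OF ordIso_symmetric[OF dim]])
  finally show ?thesis .
qed

theorem corollary0p5:
  fixes scaleC :: "complex \<Rightarrow> 'b::real_normed_vector \<Rightarrow> 'b"
  shows "(normed_barrelled_space ((*\<^sub>R) :: real \<Rightarrow> 'a::real_normed_vector \<Rightarrow> 'a)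
            \<and> cinfinite (alg_dim ((*\<^sub>R) :: real \<Rightarrow> 'a \<Rightarrow> 'a))
          \<longrightarrow> cov_null \<le>o alg_dim ((*\<^sub>R) :: real \<Rightarrow> 'a \<Rightarrow> 'a))
       \<and> (normed_barrelled_space scaleC \<and> cinfinite (alg_dim scaleC)
          \<longrightarrow> cov_null \<le>o alg_dim scaleC)"
proof (intro conjI impI; elim conjE)
  assume "normed_barrelled_space ((*\<^sub>R) :: real \<Rightarrow> 'a \<Rightarrow> 'a)"
    and "cinfinite (alg_dim ((*\<^sub>R) :: real \<Rightarrow> 'a \<Rightarrow> 'a))"
  moreover have "\<exists>s t. \<bar>s\<bar> \<le> norm c \<and> \<bar>t\<bar> \<le> norm c \<and> c = of_real s + of_real t * 0" for c :: real
    by (intro exI[of _ c] exI[of _ 0]) simp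
  ultimately show "cov_null \<le>o alg_dim ((*\<^sub>R) :: real \<Rightarrow> 'a \<Rightarrow> 'a)"
    by (rule cov_null_le_alg_dim)
next
  assume "normed_barrelled_space scaleC" and "cinfinite (alg_dim scaleC)"
  moreover have "\<exists>s t. \<bar>s\<bar> \<le> norm c \<and> \<bar>t\<bar> \<le> norm c \<and> c = of_real s + of_real t * \<i>" for c :: complex
    by (intro exI[of _ "Re c"] exI[of _ "Im c"])
      (auto simp: abs_Re_le_cmod abs_Im_le_cmod complex_eq_iff)
  ultimately show "cov_null \<le>o alg_dim scaleC"
    by (rule cov_null_le_alg_dim)
qed

end
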